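(* ($\mathsf{ZFC}$) $\mathsf{BA}_{\rm Lip}(\omega^\omega)$ implies $\mathsf{BA}_{\rm Lip}(2^\omega)$.
   Context: On $\omega^\omega$ use the metric $d(x,y)=2^{-k}$ where $k$ is least with $x(k)\neq y(k)$ (and $d(x,x)=0$); $2^\omega$ carries the restricted metric. Lipschitz always means with constant $1$: $f$ is Lipschitz if for all $x,y$ in its domain and all $k<\omega$, $x\upharpoonright k=y\upharpoonright k$ implies $f(x)\upharpoonright k=f(y)\upharpoonright k$. A subset of a topological space is $\aleph_1$-dense if its intersection with every non-empty open set has size exactly $\aleph_1$. For $Z\in\{\omega^\omega,2^\omega\}$, $\mathsf{BA}_{\rm Lip}(Z)$ is the statement: for all $\aleph_1$-dense $A,B\subseteq Z$ there is a Lipschitz $f:Z\to Z$ such that $f\upharpoonright A$ is injective and $f``A\subseteq B$. *)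

theory Defs
  imports "HOL-Analysis.Analysis"
begin

definition Baire_space :: "(nat \<Rightarrow> nat) set" where
  "Baire_space = UNIV"

definition Cantor_space :: "(nat \<Rightarrow> nat) set" where
  "Cantor_space = UNIV \<rightarrow> {0, 1}"

definition Baire_dist :: "(nat \<Rightarrow> nat) \<Rightarrow> (nat \<Rightarrow> nat) \<Rightarrow> real" where
  "Baire_dist x y = (if x = y then 0 else 1 / 2 ^ (LEAST k. x k \<noteq> y k))"

lemma Baire_dist_le_iff: "Baire_dist x y \<le> 1 / 2 ^ k \<longleftrightarrow> (\<forall>i<k. x i = y i)"
proof (cases "x = y")
  case False
  then obtain n where n: "x n \<noteq> y n" by auto
  define l where "l = (LEAST k. x k \<noteq> y k)"
  have l: "x l \<noteq> y l" unfolding l_def using n by (rule LeastI)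
  have below: "x i = y i" if "i < l" for i
    using not_less_Least[of i "\<lambda>k. x k \<noteq> y k"] that by (auto simp: l_def)
  have "Baire_dist x y \<le> 1 / 2 ^ k \<longleftrightarrow> k \<le> l"
    using False by (simp add: Baire_dist_def l_def [symmetric] field_simps)
  also have "\<dots> \<longleftrightarrow> (\<forall>i<k. x i = y i)"
  proof
    show "\<forall>i<k. x i = y i" if "k \<le> l" using that below by simp
    show "k \<le> l" if "\<forall>i<k. x i = y i" using that l not_le by blast
  qed
  finally show ?thesis .
qed (simp add: Baire_dist_def)

lemma Metric_space_Baire_dist: "Metric_space Z Baire_dist"
proof
  show "0 \<le> Baire_dist x y" for x y by (simp add: Baire_dist_def)
  show "Baire_dist x y = Baire_dist y x" for x y by (simp add: Baire_dist_def eq_commute)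
  show "Baire_dist x y = 0 \<longleftrightarrow> x = y" for x y by (simp add: Baire_dist_def)
  show "Baire_dist x z \<le> Baire_dist x y + Baire_dist y z" for x y z
  proof -
    show ?thesis
    proof (cases "x = y \<or> y = z")
      case False
      obtain a where a: "Baire_dist x y = 1 / 2 ^ a" using False by (auto simp: Baire_dist_def)
      obtain b where b: "Baire_dist y z = 1 / 2 ^ b" using False by (auto simp: Baire_dist_def)
      have "Baire_dist x z \<le> 1 / 2 ^ min a b"
        using Baire_dist_le_iff[of x y a] Baire_dist_le_iff[of y z b] a b
        by (simp add: Baire_dist_le_iff)
      also have "\<dots> \<le> 1 / 2 ^ a + 1 / 2 ^ b" by (simp add: min_def)
      finally show ?thesis using a b by simp
    qed (auto simp: Baire_dist_def)
  qed
qed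

definition Lipschitz_on :: "(nat \<Rightarrow> nat) set \<Rightarrow> ((nat \<Rightarrow> nat) \<Rightarrow> (nat \<Rightarrow> nat)) \<Rightarrow> bool" where
  "Lipschitz_on Z f \<longleftrightarrow>
     (\<forall>x\<in>Z. \<forall>y\<in>Z. \<forall>k. (\<forall>i<k. x i = y i) \<longrightarrow> (\<forall>i<k. f x i = f y i))"

lemma Lipschitz_on_iff_Baire_dist:
  "Lipschitz_on Z f \<longleftrightarrow> (\<forall>x\<in>Z. \<forall>y\<in>Z. Baire_dist (f x) (f y) \<le> Baire_dist x y)"
proof
  assume L: "Lipschitz_on Z f"
  show "\<forall>x\<in>Z. \<forall>y\<in>Z. Baire_dist (f x) (f y) \<le> Baire_dist x y"
  proof (intro ballI)
    fix x y assume xy: "x \<in> Z" "y \<in> Z"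
    show "Baire_dist (f x) (f y) \<le> Baire_dist x y"
    proof (cases "x = y")
      case False
      then obtain a where a: "Baire_dist x y = 1 / 2 ^ a" by (auto simp: Baire_dist_def)
      then have "\<forall>i<a. x i = y i" using Baire_dist_le_iff[of x y a] by simp
      then have "\<forall>i<a. f x i = f y i" using L xy unfolding Lipschitz_on_def by blast
      then show ?thesis unfolding a by (simp only: Baire_dist_le_iff)
    qed (simp add: Baire_dist_def)
  qed
next
  assume R: "\<forall>x\<in>Z. \<forall>y\<in>Z. Baire_dist (f x) (f y) \<le> Baire_dist x y"
  show "Lipschitz_on Z f"
    unfolding Lipschitz_on_def
  proof (intro ballI allI impI)
    fix x y k i assume "x \<in> Z" "y \<in> Z" and eq: "\<forall>i<k. x i = y i" and "i < k"
    then have "Baire_dist (f x) (f y) \<le> Baire_dist x y" using R by blast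
    also have "\<dots> \<le> 1 / 2 ^ k" using eq by (simp only: Baire_dist_le_iff)
    finally show "f x i = f y i" using \<open>i < k\<close> by (simp only: Baire_dist_le_iff)
  qed
qed

text \<open>The first uncountable cardinal is the cardinal successor of \<^term>\<open>natLeq\<close>.\<close>

definition aleph1_dense_in :: "'a topology \<Rightarrow> 'a set \<Rightarrow> bool" where
  "aleph1_dense_in X A \<longleftrightarrow>
     A \<subseteq> topspace X \<and>
     (\<forall>U. openin X U \<and> U \<noteq> {} \<longrightarrow>
        (card_of (A \<inter> U), cardSuc natLeq) \<in> ordIso)"

definition BA_Lip :: "(nat \<Rightarrow> nat) set \<Rightarrow> bool" where
  "BA_Lip Z \<longleftrightarrow>
     (\<forall>A B. aleph1_dense_in (Metric_space.mtopology Z Baire_dist) A \<and>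
            aleph1_dense_in (Metric_space.mtopology Z Baire_dist) B \<longrightarrow>
        (\<exists>f \<in> Z \<rightarrow> Z. Lipschitz_on Z f \<and> inj_on f A \<and> f ` A \<subseteq> B))"

end

theory Submission
  imports Defs
begin

text \<open>
  Reduction modulo 2 is a Lipschitz retraction of \<open>\<omega>\<^sup>\<omega>\<close> onto \<open>2\<^sup>\<omega>\<close> that maps each basic clopen
  set \<open>[s]\<close> onto \<open>[s mod 2]\<close>. Choose pairwise disjoint uncountable sets \<open>D\<^sub>s \<subseteq> B \<inter> [s mod 2]\<close>,
  one for each finite sequence \<open>s\<close>, and lift each \<open>b \<in> D\<^sub>s\<close> to a preimage in \<open>[s]\<close>. The set \<open>B'\<close>
  of all lifts is \<open>\<aleph>\<^sub>1\<close>-dense in \<open>\<omega>\<^sup>\<omega>\<close>, and reduction modulo 2 maps it injectively into \<open>B\<close>.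
  Composing this reduction with a Lipschitz map that sends \<open>A \<union> B'\<close> injectively into \<open>B'\<close>
  gives the required map.
\<close>

section \<open>Disjoint refinements of uncountable sets\<close>

text \<open>Recursion on \<open>n\<close>: only countably many points are forbidden at stage
  \<open>n\<close>, namely \<open>S\<close> and the earlier values, so \<open>C n\<close> still
  offers one. The condition on \<open>p n\<close> depends only on values below \<open>n\<close>, as
  the recursion requires.\<close>

lemma transversal_avoiding_countable:
  fixes C :: "nat \<Rightarrow> 'a set"
  assumes "\<And>n. uncountable (C n)" and "countable S"
  obtains p where "inj p" "\<And>n. p n \<in> C n - S"
proof -
  have "\<exists>p. \<forall>n. p n \<in> C n - S - p ` {..<n}"
  proof (rule dependent_wellorder_choice)
    show "\<exists>r. r \<in> C n - S - p ` {..<n}" for n and p :: "nat \<Rightarrow> 'a"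
    proof -
      have "countable (S \<union> p ` {..<n})"
        using assms(2) by simp
      then have "uncountable (C n - (S \<union> p ` {..<n}))"
        using assms(1) by (simp add: uncountable_minus_countable)
      then have "C n - (S \<union> p ` {..<n}) \<noteq> {}"
        by (metis countable_empty)
      then show ?thesis by blast
    qed
  qed auto
  then obtain p where p: "\<And>n. p n \<in> C n - S - p ` {..<n}" by blast
  have "p m \<noteq> p n" if "m < n" for m n
    using p[of n] that by (metis Diff_iff imageI lessThan_iff)
  then have "inj p" by (metis injI linorder_neqE_nat)
  then show thesis using p that by blast
qed

text \<open>
  By Zorn's lemma there is a maximal family of injective transversals with pairwise disjoint
  ranges. It is uncountable by maximality, and its values at \<open>n\<close> form \<open>D n\<close>.
\<close>

lemma disjoint_uncountable_refinement_nat: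
  fixes C :: "nat \<Rightarrow> 'a set"
  assumes C: "\<And>n. uncountable (C n)"
  obtains D where "\<And>n. D n \<subseteq> C n" "\<And>n. uncountable (D n)" "disjoint_family D"
proof -
  define T where "T = {p. inj p \<and> (\<forall>n. p n \<in> C n)}"
  define \<F> where "\<F> = {F. F \<subseteq> T \<and> pairwise (\<lambda>p q. range p \<inter> range q = {}) F}"
  have "\<exists>F\<in>\<F>. \<forall>G\<in>\<F>. F \<subseteq> G \<longrightarrow> G = F"
  proof (rule Zorn_Lemma, intro ballI)
    fix \<C> assume \<C>: "\<C> \<in> chains \<F>"
    then have "\<Union>\<C> \<subseteq> T"
      by (auto simp: chains_def \<F>_def)
    moreover have "pairwise (\<lambda>p q. range p \<inter> range q = {}) (\<Union>\<C>)"
      using \<C> by (intro pairwise_chain_Union) (auto simp: \<F>_def chains_def)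
    ultimately show "\<Union>\<C> \<in> \<F>" by (simp add: \<F>_def)
  qed
  then obtain F where F: "F \<in> \<F>" and max: "\<And>G. G \<in> \<F> \<Longrightarrow> F \<subseteq> G \<Longrightarrow> G = F" by blast
  \<comment> \<open>The indices may differ: the case \<open>m = n\<close> makes evaluation at
    \<open>n\<close> injective on \<open>F\<close>, and the case of distinct indices separates the
    sets \<open>D n\<close>.\<close>
  have disj: "p = q" if "p \<in> F" "q \<in> F" "p m = q n" for p q m n
    using F that unfolding \<F>_def pairwise_def by fastforce
  have T: "inj p" "p n \<in> C n" if "p \<in> F" for p n
    using F that by (auto simp: \<F>_def T_def)
  have unc: "uncountable F"
  proof
    assume "countable F"
    \<comment> \<open>A transversal avoiding this countable union could be added to
      \<open>F\<close>, contradicting maximality.\<close>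
    then have "countable (\<Union>p\<in>F. range p)" by simp
    then obtain p where p: "inj p" "\<And>n. p n \<in> C n - (\<Union>p\<in>F. range p)"
      using transversal_avoiding_countable[where C = C and S = "\<Union>p\<in>F. range p"] C by blast
    have "p m \<noteq> q n" if "q \<in> F" for q m n
      using p(2)[of m] that by blast
    then have "range p \<inter> range q = {}" "range q \<inter> range p = {}" if "q \<in> F" for q
      using that by (metis disjoint_iff imageE)+
    moreover have "p \<in> T" using p by (simp add: T_def)
    ultimately have "insert p F \<in> \<F>"
      using F by (simp add: \<F>_def pairwise_insert)
    then have "p \<in> F" using max by blast
    then show False using p(2) by blast
  qed
  define D where "D = (\<lambda>n. (\<lambda>p. p n) ` F)"
  show thesis
  proof
    show "D n \<subseteq> C n" for n using T by (auto simp: D_def)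
    have "inj_on (\<lambda>p. p n) F" for n using disj by (blast intro: inj_onI)
    then show "uncountable (D n)" for n
      using unc by (metis D_def countable_image_inj_on)
    show "disjoint_family D"
      unfolding disjoint_family_on_def
    proof (intro ballI impI)
      fix m n :: nat assume "m \<noteq> n"
      have False if "p \<in> F" "q \<in> F" "p m = q n" for p q
        using disj[OF that] T(1)[OF that(1)] that(3) \<open>m \<noteq> n\<close> by (simp add: inj_eq)
      then show "D m \<inter> D n = {}" by (auto simp: D_def)
    qed
  qed
qed

lemma disjoint_uncountable_refinement:
  fixes C :: "'i::countable \<Rightarrow> 'a set"
  assumes C: "\<And>i. uncountable (C i)"
  obtains D where "\<And>i. D i \<subseteq> C i" "\<And>i. uncountable (D i)" "disjoint_family D"
proof -
  obtain E where E: "\<And>n. E n \<subseteq> C (from_nat n)" "\<And>n. uncountable (E n)" "disjoint_family E"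
    using disjoint_uncountable_refinement_nat[of "C \<circ> from_nat"] C by auto
  show thesis
  proof
    show "E (to_nat i) \<subseteq> C i" for i using E(1)[of "to_nat i"] by simp
    show "uncountable (E (to_nat i))" for i by (rule E(2))
    show "disjoint_family (\<lambda>i. E (to_nat i))"
      using E(3) by (simp add: disjoint_family_on_def)
  qed
qed

section \<open>Density in terms of basic clopen sets\<close>

definition cylinder :: "nat list \<Rightarrow> (nat \<Rightarrow> nat) set" where
  "cylinder s = {x. \<forall>i<length s. x i = s ! i}"

text \<open>By the successor property, having size at least \<open>cardSuc natLeq\<close> is the
  same as exceeding \<open>natLeq\<close>, that is, being uncountable. This separates the lower
  bound from the upper bound.\<close>

lemma ordIso_aleph1_iff:
  "(card_of S, cardSuc natLeq) \<in> ordIso \<longleftrightarrow>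
     uncountable S \<and> (card_of S, cardSuc natLeq) \<in> ordLeq"
proof -
  have "countable S \<longleftrightarrow> (card_of S, card_of (UNIV :: nat set)) \<in> ordLeq"
    by (simp add: countable_def flip: card_of_ordLeq)
  also have "\<dots> \<longleftrightarrow> (card_of S, natLeq) \<in> ordLeq"
    using ordLeq_ordIso_trans[OF _ card_of_nat]
      ordLeq_ordIso_trans[OF _ ordIso_symmetric[OF card_of_nat]] by (rule iffI)
  finally have "uncountable S \<longleftrightarrow> (natLeq, card_of S) \<in> ordLess"
    using not_ordLeq_iff_ordLess[OF natLeq_Well_order card_of_Well_order] by metis
  also have "\<dots> \<longleftrightarrow> (cardSuc natLeq, card_of S) \<in> ordLeq"
    by (rule cardSuc_ordLess_ordLeq[OF natLeq_Card_order card_of_Card_order])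
  finally show ?thesis
    by (auto simp: ordIso_iff_ordLeq)
qed

lemma open_cylinder: "openin (Metric_space.mtopology Z Baire_dist) (Z \<inter> cylinder s)"
proof -
  interpret Metric_space Z Baire_dist by (rule Metric_space_Baire_dist)
  have "mball x (1 / 2 ^ length s) \<subseteq> Z \<inter> cylinder s" if "x \<in> Z \<inter> cylinder s" for x
  proof
    fix y assume "y \<in> mball x (1 / 2 ^ length s)"
    then have "y \<in> Z" "Baire_dist x y \<le> 1 / 2 ^ length s" by auto
    with that show "y \<in> Z \<inter> cylinder s"
      by (simp add: Baire_dist_le_iff cylinder_def)
  qed
  then show ?thesis
    unfolding openin_mtopology
    by (metis Int_lower1 zero_less_divide_1_iff zero_less_numeral zero_less_power)
qed

lemma open_contains_cylinder:
  assumes "openin (Metric_space.mtopology Z Baire_dist) U" and "x \<in> U"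
  obtains s where "x \<in> cylinder s" "Z \<inter> cylinder s \<subseteq> U"
proof -
  interpret Metric_space Z Baire_dist by (rule Metric_space_Baire_dist)
  obtain r where r: "r > 0" "mball x r \<subseteq> U" and xZ: "x \<in> Z"
    using assms unfolding openin_mtopology by blast
  obtain k where k: "(1 / 2) ^ k < r"
    using r(1) real_arch_pow_inv[of r "1 / 2"] by auto
  \<comment> \<open>Agreement with \<open>x\<close> on the first \<open>k\<close> values means
    distance at most \<open>1 / 2 ^ k\<close>, which is below \<open>r\<close>.\<close>
  have "Z \<inter> cylinder (map x [0..<k]) \<subseteq> mball x r"
  proof
    fix y assume y: "y \<in> Z \<inter> cylinder (map x [0..<k])"
    then have "Baire_dist x y \<le> 1 / 2 ^ k"
      unfolding Baire_dist_le_iff by (simp add: cylinder_def)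
    with k y xZ show "y \<in> mball x r" by (simp add: power_one_over)
  qed
  moreover have "x \<in> cylinder (map x [0..<k])" by (simp add: cylinder_def)
  ultimately show thesis using r(2) that by blast
qed

text \<open>The upper bound passes to subsets, so it is enough to state it once for
  \<open>A\<close>; it is read off from the open set \<open>Z\<close> itself. Uncountability passes
  to supersets, so it is enough to test it on cylinders.\<close>

lemma aleph1_dense_in_iff_cylinder:
  assumes "Z \<noteq> {}"
  shows "aleph1_dense_in (Metric_space.mtopology Z Baire_dist) A \<longleftrightarrow>
     A \<subseteq> Z \<and> (card_of A, cardSuc natLeq) \<in> ordLeq \<and>
     (\<forall>s. Z \<inter> cylinder s \<noteq> {} \<longrightarrow> uncountable (A \<inter> cylinder s))"
    (is "?L \<longleftrightarrow> ?R")
proof -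
  interpret Metric_space Z Baire_dist by (rule Metric_space_Baire_dist)
  show ?thesis
  proof
    assume ?L
    then have AZ: "A \<subseteq> Z"
      and iso: "\<And>U. openin mtopology U \<Longrightarrow> U \<noteq> {} \<Longrightarrow> (card_of (A \<inter> U), cardSuc natLeq) \<in> ordIso"
      by (auto simp: aleph1_dense_in_def)
    have "(card_of A, cardSuc natLeq) \<in> ordLeq"
      using iso[of Z] assms AZ by (simp add: Int_absorb2 ordIso_aleph1_iff)
    moreover have "uncountable (A \<inter> cylinder s)" if "Z \<inter> cylinder s \<noteq> {}" for s
      using iso[OF open_cylinder that] AZ
      by (simp add: ordIso_aleph1_iff Int_absorb2 flip: Int_assoc)
    ultimately show ?R using AZ by blast
  next
    assume R: ?R
    have "(card_of (A \<inter> U), cardSuc natLeq) \<in> ordIso"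
      if U: "openin mtopology U" "U \<noteq> {}" for U
    proof -
      obtain x where x: "x \<in> U" using U by blast
      obtain s where s: "x \<in> cylinder s" "Z \<inter> cylinder s \<subseteq> U"
        using open_contains_cylinder[OF U(1) x] .
      have "x \<in> Z" using openin_subset[OF U(1)] x by auto
      then have "uncountable (A \<inter> cylinder s)" using R s(1) by blast
      moreover have "A \<inter> cylinder s \<subseteq> A \<inter> U" using R s(2) by blast
      ultimately have "uncountable (A \<inter> U)" using countable_subset by blast
      moreover have "(card_of (A \<inter> U), cardSuc natLeq) \<in> ordLeq"
        using R by (meson card_of_mono1 inf_le1 ordLeq_transitive)
      ultimately show ?thesis by (simp add: ordIso_aleph1_iff)
    qed
    then show ?L using R by (simp add: aleph1_dense_in_def)
  qed
qed

section \<open>Lifting along reduction modulo 2\<close>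

definition splice_prefix :: "nat list \<Rightarrow> (nat \<Rightarrow> nat) \<Rightarrow> nat \<Rightarrow> nat" where
  "splice_prefix s x i = (if i < length s then s ! i else x i)"

definition mod2 :: "(nat \<Rightarrow> nat) \<Rightarrow> nat \<Rightarrow> nat" where
  "mod2 x i = x i mod 2"

lemma mod2_in_Cantor_space: "mod2 x \<in> Cantor_space"
  by (auto simp: mod2_def Cantor_space_def)

lemma splice_prefix_in_cylinder: "splice_prefix s x \<in> cylinder s"
  by (simp add: splice_prefix_def cylinder_def)

text \<open>On the prefix the cylinder condition says that \<open>s\<close> reduces to
  \<open>x\<close>; beyond it the values of \<open>x\<close> are 0 or 1, hence fixed by
  reduction.\<close>

lemma mod2_splice_prefix:
  assumes "x \<in> Cantor_space" and "x \<in> cylinder (map (\<lambda>k. k mod 2) s)"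
  shows "mod2 (splice_prefix s x) = x"
proof
  fix i
  have "x i \<in> {0, 1}" using assms(1) by (auto simp: Cantor_space_def)
  then show "mod2 (splice_prefix s x) i = x i"
    using assms(2) by (auto simp: mod2_def splice_prefix_def cylinder_def)
qed

lemma Cantor_space_meets_cylinder_mod2:
  "Cantor_space \<inter> cylinder (map (\<lambda>k. k mod 2) s) \<noteq> {}"
proof -
  have "mod2 (splice_prefix s x) \<in> cylinder (map (\<lambda>k. k mod 2) s)" for x
    by (simp add: mod2_def splice_prefix_def cylinder_def)
  then show ?thesis using mod2_in_Cantor_space by blast
qed

lemma aleph1_dense_lift:
  assumes "aleph1_dense_in (Metric_space.mtopology Cantor_space Baire_dist) B"
  obtains B' where "aleph1_dense_in (Metric_space.mtopology Baire_space Baire_dist) B'"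
    "inj_on mod2 B'" "mod2 ` B' \<subseteq> B"
proof -
  have "Cantor_space \<noteq> {}" using Cantor_space_meets_cylinder_mod2 by blast
  with assms have B: "B \<subseteq> Cantor_space" "(card_of B, cardSuc natLeq) \<in> ordLeq"
    and dense: "\<And>s. Cantor_space \<inter> cylinder s \<noteq> {} \<Longrightarrow> uncountable (B \<inter> cylinder s)"
    by (simp_all add: aleph1_dense_in_iff_cylinder)
  have "uncountable (B \<inter> cylinder (map (\<lambda>k. k mod 2) s))" for s
    by (rule dense[OF Cantor_space_meets_cylinder_mod2])
  then obtain D where D: "\<And>s. D s \<subseteq> B \<inter> cylinder (map (\<lambda>k. k mod 2) s)"
      "\<And>s. uncountable (D s)" and disj: "disjoint_family D"
    using disjoint_uncountable_refinement[of "\<lambda>s. B \<inter> cylinder (map (\<lambda>k. k mod 2) s)"] by blast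
  have mod2: "mod2 (splice_prefix s b) = b" if "b \<in> D s" for s b
    using D(1) B(1) that by (intro mod2_splice_prefix) auto
  define B' where "B' = (\<Union>s. splice_prefix s ` D s)"
  have inj: "inj_on mod2 B'"
  proof (rule inj_onI)
    fix x y assume "x \<in> B'" "y \<in> B'" and eq: "mod2 x = mod2 y"
    then obtain s b t c where "x = splice_prefix s b" "b \<in> D s" "y = splice_prefix t c" "c \<in> D t"
      by (auto simp: B'_def)
    moreover from this have "b = c" using eq mod2 by simp
    \<comment> \<open>The common point \<open>b = c\<close> lies in both \<open>D s\<close> and
      \<open>D t\<close>, so disjointness forces \<open>s = t\<close> and the two lifts
      coincide.\<close>
    ultimately show "x = y" using disj by (metis disjoint_family_onD disjoint_iff UNIV_I)
  qed
  have sub: "mod2 ` B' \<subseteq> B" using D(1) mod2 by (force simp: B'_def)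
  have "(card_of B', card_of B) \<in> ordLeq"
    using inj sub card_of_ordLeq by blast
  then have "(card_of B', cardSuc natLeq) \<in> ordLeq"
    using B(2) ordLeq_transitive by blast
  moreover have "uncountable (B' \<inter> cylinder s)" for s
  proof -
    \<comment> \<open>On \<open>D s\<close> the map \<open>mod2\<close> is a left inverse of
      \<open>splice_prefix s\<close>.\<close>
    have "inj_on (splice_prefix s) (D s)" using mod2 by (metis inj_onI)
    then have "uncountable (splice_prefix s ` D s)"
      using D(2) countable_image_inj_on by blast
    moreover have "splice_prefix s ` D s \<subseteq> B' \<inter> cylinder s"
      using splice_prefix_in_cylinder by (auto simp: B'_def)
    ultimately show ?thesis using countable_subset by blast
  qed
  ultimately have "aleph1_dense_in (Metric_space.mtopology Baire_space Baire_dist) B'"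
    by (simp add: aleph1_dense_in_iff_cylinder Baire_space_def)
  then show thesis using inj sub that by blast
qed

text \<open>A subset of the Cantor space is not dense in the Baire space, so \<open>A\<close> has to
  be enlarged before the hypothesis applies to it. The union keeps the size bound because
  \<open>cardSuc natLeq\<close> is infinite.\<close>

lemma aleph1_dense_Un:
  assumes "aleph1_dense_in (Metric_space.mtopology Z Baire_dist) B"
    and "A \<subseteq> Z" "(card_of A, cardSuc natLeq) \<in> ordLeq" "Z \<noteq> {}"
  shows "aleph1_dense_in (Metric_space.mtopology Z Baire_dist) (A \<union> B)"
proof -
  have "(card_of (A \<union> B), cardSuc natLeq) \<in> ordLeq"
    using assms Cinfinite_cardSuc[OF natLeq_Cinfinite]
    by (intro card_of_Un_ordLeq_infinite_Field)
      (simp_all add: aleph1_dense_in_iff_cylinder cinfinite_def)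
  then show ?thesis
    using assms by (simp add: aleph1_dense_in_iff_cylinder Int_Un_distrib2)
qed

theorem theorem1p3:
  assumes "BA_Lip Baire_space"
  shows "BA_Lip Cantor_space"
  unfolding BA_Lip_def
proof (intro allI impI, elim conjE)
  fix A B
  assume A: "aleph1_dense_in (Metric_space.mtopology Cantor_space Baire_dist) A"
    and B: "aleph1_dense_in (Metric_space.mtopology Cantor_space Baire_dist) B"
  obtain B' where B': "aleph1_dense_in (Metric_space.mtopology Baire_space Baire_dist) B'"
    and inj: "inj_on mod2 B'" and sub: "mod2 ` B' \<subseteq> B"
    using aleph1_dense_lift[OF B] .
  have "Cantor_space \<noteq> {}" using mod2_in_Cantor_space by blast
  with A have "(card_of A, cardSuc natLeq) \<in> ordLeq"
    by (simp add: aleph1_dense_in_iff_cylinder)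
  then have "aleph1_dense_in (Metric_space.mtopology Baire_space Baire_dist) (A \<union> B')"
    by (intro aleph1_dense_Un[OF B']) (auto simp: Baire_space_def)
  then obtain f where f: "Lipschitz_on Baire_space f" "inj_on f (A \<union> B')" "f ` (A \<union> B') \<subseteq> B'"
    using assms B' unfolding BA_Lip_def by blast
  show "\<exists>f\<in>Cantor_space \<rightarrow> Cantor_space.
      Lipschitz_on Cantor_space f \<and> inj_on f A \<and> f ` A \<subseteq> B"
  proof (intro bexI conjI)
    show "mod2 \<circ> f \<in> Cantor_space \<rightarrow> Cantor_space"
      using mod2_in_Cantor_space by simp
    show "Lipschitz_on Cantor_space (mod2 \<circ> f)"
      using f(1) by (simp add: Lipschitz_on_def Baire_space_def mod2_def)
    \<comment> \<open>Since \<open>f\<close> sends \<open>A\<close> into \<open>B'\<close>, where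
      \<open>mod2\<close> is injective, the composition stays injective on \<open>A\<close>.\<close>
    have "inj_on f A" "f ` A \<subseteq> B'" using f(2,3) by (auto intro: inj_on_subset)
    then show "inj_on (mod2 \<circ> f) A"
      using inj by (blast intro: comp_inj_on inj_on_subset)
    show "(mod2 \<circ> f) ` A \<subseteq> B"
      using \<open>f ` A \<subseteq> B'\<close> sub by auto
  qed
qed

end
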